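(* For every proximity parameter $\epsilon>0$ there exists an adaptive randomized tester for the unateness property which, given oracle (query) access to a Boolean function $f:\{0,1\}^n \to \{0,1\}$, makes $O(n \log(n)/\epsilon)$ adaptive queries to $f$, always accepts if $f$ is unate, and rejects with probability at least $0.9$ if $f$ is $\epsilon$-far from being unate.
   Context: A Boolean function $f:\{0,1\}^n\to\{0,1\}$ is unate if for every $i\in[n]$, $f$ is either monotone non-increasing in the $i$-th coordinate or monotone non-decreasing in the $i$-th coordinate. Equivalently, there are directions $b_i\in\{up,down\}$ ($i\in[n]$) such that $f(x)\le f(y)$ whenever $x\prec_B y$, where $x\prec_B y$ means $x_i\le y_i$ for all $i$ with $b_i=up$ and $x_i\ge y_i$ for all $i$ with $b_i=down$. The distance between $f,g:\{0,1\}^n\to\{0,1\}$ is ${\sf distance}(f,g)=\Pr_{x\in\{0,1\}^n}[f(x)\neq g(x)]$ with $x$ uniform, and $f$ is $\epsilon$-far from being unate if ${\sf distance}(f,g)\ge\epsilon$ for every unate $g$. A tester may query the value $f(x)$ at points $x$ of its choice; adaptive means each query may depend on answers to previous queries. *)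

theory Defs
  imports "HOL-Probability.Probability"
begin

definition cube :: "nat \<Rightarrow> (nat \<Rightarrow> bool) set" where
  "cube n = {..<n} \<rightarrow>\<^sub>E (UNIV :: bool set)"

text \<open>
  A Boolean function on the \<open>n\<close>-dimensional cube is a function \<open>f :: (nat \<Rightarrow> bool) \<Rightarrow> bool\<close>
  of which only the values on \<^term>\<open>cube n\<close> matter.  Values and coordinates are ordered by the
  library order on \<^typ>\<open>bool\<close>, that is, \<^term>\<open>False < True\<close>.
\<close>

definition nondecreasing_in :: "nat \<Rightarrow> nat \<Rightarrow> ((nat \<Rightarrow> bool) \<Rightarrow> bool) \<Rightarrow> bool" where
  "nondecreasing_in n i f \<longleftrightarrow> (\<forall>x\<in>cube n. mono (\<lambda>b. f (x(i := b))))"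

definition nonincreasing_in :: "nat \<Rightarrow> nat \<Rightarrow> ((nat \<Rightarrow> bool) \<Rightarrow> bool) \<Rightarrow> bool" where
  "nonincreasing_in n i f \<longleftrightarrow> (\<forall>x\<in>cube n. antimono (\<lambda>b. f (x(i := b))))"

definition unate :: "nat \<Rightarrow> ((nat \<Rightarrow> bool) \<Rightarrow> bool) \<Rightarrow> bool" where
  "unate n f \<longleftrightarrow> (\<forall>i<n. nonincreasing_in n i f \<or> nondecreasing_in n i f)"

definition distance ::
    "nat \<Rightarrow> ((nat \<Rightarrow> bool) \<Rightarrow> bool) \<Rightarrow> ((nat \<Rightarrow> bool) \<Rightarrow> bool) \<Rightarrow> real" where
  "distance n f g = measure_pmf.prob (pmf_of_set (cube n)) {x. f x \<noteq> g x}"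

definition far_from_unate :: "nat \<Rightarrow> real \<Rightarrow> ((nat \<Rightarrow> bool) \<Rightarrow> bool) \<Rightarrow> bool" where
  "far_from_unate n \<epsilon> f \<longleftrightarrow> (\<forall>g. unate n g \<longrightarrow> distance n f g \<ge> \<epsilon>)"

text \<open>
  A deterministic adaptive query algorithm is a decision tree: it either stops with a verdict
  (\<^term>\<open>True\<close> means accept) or queries a point and continues depending on the answer.  A randomized
  algorithm is a probability distribution on such trees.  The set function \<open>query_points\<close>
  collects the points queried anywhere in the tree.
\<close>

datatype (query_points: 'p) query_tree =
    Verdict bool
  | Query 'p "bool \<Rightarrow> 'p query_tree"

type_synonym randomized_tester = "(nat \<Rightarrow> bool) query_tree pmf"

primrec accepts :: "('p \<Rightarrow> bool) \<Rightarrow> 'p query_tree \<Rightarrow> bool" where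
  "accepts f (Verdict b) \<longleftrightarrow> b"
| "accepts f (Query x k) \<longleftrightarrow> accepts f (k (f x))"

primrec num_queries :: "('p \<Rightarrow> bool) \<Rightarrow> 'p query_tree \<Rightarrow> nat" where
  "num_queries f (Verdict b) = 0"
| "num_queries f (Query x k) = Suc (num_queries f (k (f x)))"

end

(* Let u_i and d_i be the fractions of increasing and decreasing edges in direction i.  Sorting f
   along one coordinate after the other, each time in the direction in which f has fewer violating
   edges, yields a unate function; it never creates violations in other directions, so an f that is
   epsilon-far from unate satisfies sum_i min(u_i, d_i) >= epsilon.  The tester makes O(1/epsilon)
   passes over all directions.  For direction i it samples one edge; if that edge is non-constant,
   which happens with probability p_i = u_i + d_i, it samples until it finds a second one, in 1/p_i
   expected attempts, and rejects if the two disagree.  Hence a direction costs O(1) expected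
   queries and leads to rejection with probability 2 u_i d_i / p_i >= min(u_i, d_i), up to a factor
   2 lost to bounding the number of attempts.  Markov's inequality turns the expected number of
   queries into a worst-case bound: the resulting O(n/epsilon) is below O(n log n/epsilon) for
   n >= 2, and for n = 1 every function is unate. *)

theory Submission
  imports Defs
begin

section \<open>Sorting along a coordinate\<close>

text \<open>Points are collected instead of edges: a violating edge contributes both endpoints, and
  these are the points that change when it is sorted. For \<open>b = True\<close> the violating
  edges are the decreasing ones.\<close>

definition violations :: "nat \<Rightarrow> nat \<Rightarrow> bool \<Rightarrow> ((nat \<Rightarrow> bool) \<Rightarrow> bool) \<Rightarrow> (nat \<Rightarrow> bool) set" where
  "violations n i b f = {x \<in> cube n. f (x(i := \<not> b)) \<and> \<not> f (x(i := b))}"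

definition sort_coord :: "nat \<Rightarrow> bool \<Rightarrow> ((nat \<Rightarrow> bool) \<Rightarrow> bool) \<Rightarrow> (nat \<Rightarrow> bool) \<Rightarrow> bool" where
  "sort_coord i b f x \<longleftrightarrow>
     (if x i = b then f (x(i := \<not> b)) \<or> f (x(i := b)) else f (x(i := \<not> b)) \<and> f (x(i := b)))"

lemma finite_cube [simp]: "finite (cube n)"
  unfolding cube_def by (intro finite_PiE) auto

lemma cube_nonempty [simp]: "cube n \<noteq> {}"
  unfolding cube_def by (simp add: PiE_eq_empty_iff)

lemma card_cube: "card (cube n) = 2 ^ n"
  unfolding cube_def by (simp add: card_PiE card_UNIV_bool)

lemma fun_upd_in_cube: "x \<in> cube n \<Longrightarrow> i < n \<Longrightarrow> x(i := b) \<in> cube n"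
  unfolding cube_def by (auto simp: PiE_iff extensional_def)

lemma finite_violations [simp]: "finite (violations n i b f)"
  unfolding violations_def by simp

text \<open>Flipping coordinate \<open>i\<close> is an involution of the cube, so the doubled sum
  pairs each point with its neighbour. Inequalities between sums over the cube thereby reduce to
  single pairs.\<close>

lemma sum_cube_split:
  fixes h :: "(nat \<Rightarrow> bool) \<Rightarrow> nat"
  assumes "i < n"
  shows "2 * (\<Sum>x\<in>cube n. h x) = (\<Sum>x\<in>cube n. h (x(i := False)) + h (x(i := True)))"
proof -
  let ?flip = "\<lambda>x::nat \<Rightarrow> bool. x(i := \<not> x i)"
  have "(\<Sum>x\<in>cube n. h x) = (\<Sum>x\<in>cube n. h (?flip x))"
    by (rule sum.reindex_bij_witness[where i = ?flip and j = ?flip])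
      (auto simp: fun_upd_in_cube assms)
  then have "2 * (\<Sum>x\<in>cube n. h x) = (\<Sum>x\<in>cube n. h x + h (?flip x))"
    by (simp add: sum.distrib)
  also have "\<dots> = (\<Sum>x\<in>cube n. h (x(i := False)) + h (x(i := True)))"
  proof (rule sum.cong[OF refl])
    fix x :: "nat \<Rightarrow> bool"
    have "x(i := x i) = x" by simp
    then show "h x + h (?flip x) = h (x(i := False)) + h (x(i := True))"
      by (cases "x i") (auto simp: add.commute)
  qed
  finally show ?thesis .
qed

lemma card_violations: "card (violations n i b f) =
    (\<Sum>x\<in>cube n. of_bool (f (x(i := \<not> b)) \<and> \<not> f (x(i := b))))"
  unfolding violations_def by (simp add: Int_def flip: sum.inter_filter)

text \<open>It suffices to look at two-dimensional faces in directions \<open>i\<close> and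
  \<open>j\<close>. Sorting replaces the two parallel \<open>j\<close>-edges of a face by their
  pointwise maximum and minimum, and checking the four values shows that violations do not become
  more numerous.\<close>

lemma card_violations_sort_coord_le:
  assumes "i < n" "j \<noteq> i"
  shows "card (violations n j c (sort_coord i b f)) \<le> card (violations n j c f)"
proof -
  let ?v = "\<lambda>g x. of_bool (g (x(j := \<not> c)) \<and> \<not> g (x(j := c))) :: nat"
  have "(\<Sum>x\<in>cube n. ?v (sort_coord i b f) (x(i := False)) + ?v (sort_coord i b f) (x(i := True)))
      \<le> (\<Sum>x\<in>cube n. ?v f (x(i := False)) + ?v f (x(i := True)))"
  proof (rule sum_mono)
    fix x
    show "?v (sort_coord i b f) (x(i := False)) + ?v (sort_coord i b f) (x(i := True))
        \<le> ?v f (x(i := False)) + ?v f (x(i := True))"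
      using assms(2) unfolding sort_coord_def
      by (cases b; cases c) (auto simp: fun_upd_twist[of i j] of_bool_def)
  qed
  then show ?thesis
    unfolding card_violations
    using sum_cube_split[OF assms(1), of "?v f"] sum_cube_split[OF assms(1), of "?v (sort_coord i b f)"]
    by linarith
qed

lemma violations_sort_coord_same [simp]: "violations n i b (sort_coord i b f) = {}"
  unfolding violations_def sort_coord_def by auto

lemma sort_coord_changes: "{x \<in> cube n. f x \<noteq> sort_coord i b f x} \<subseteq> violations n i b f"
proof
  fix x assume x: "x \<in> {x \<in> cube n. f x \<noteq> sort_coord i b f x}"
  \<comment> \<open>This rewrites \<open>f x\<close> as a value at one of the two endpoints of the
    edge, the only values that sorting compares.\<close>
  have "f (x(i := x i)) = f x" by simp
  with x show "x \<in> violations n i b f"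
    unfolding violations_def sort_coord_def by (cases "x i"; cases b) (simp_all, argo+)
qed

section \<open>Unateness through violations, and the distance to it\<close>

lemma mono_bool_iff: "mono h \<longleftrightarrow> (h False \<longrightarrow> h True)"
  for h :: "bool \<Rightarrow> bool"
  unfolding mono_def le_bool_def by (auto simp: all_bool_eq ex_bool_eq)

lemma antimono_bool_iff: "antimono h \<longleftrightarrow> (h True \<longrightarrow> h False)"
  for h :: "bool \<Rightarrow> bool"
  unfolding antimono_def by (auto simp: all_bool_eq ex_bool_eq)

lemma nondecreasing_in_iff: "nondecreasing_in n i f \<longleftrightarrow> violations n i True f = {}"
  unfolding nondecreasing_in_def violations_def mono_bool_iff by auto

lemma nonincreasing_in_iff: "nonincreasing_in n i f \<longleftrightarrow> violations n i False f = {}"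
  unfolding nonincreasing_in_def violations_def antimono_bool_iff by auto

lemma unate_iff: "unate n f \<longleftrightarrow> (\<forall>i<n. \<exists>b. violations n i b f = {})"
  unfolding unate_def nondecreasing_in_iff nonincreasing_in_iff by (simp add: ex_bool_eq disj_commute)

lemma distance_eq_card: "distance n f g = card {x \<in> cube n. f x \<noteq> g x} / 2 ^ n"
  unfolding distance_def
  by (simp add: measure_pmf_of_set card_cube Int_def)

text \<open>After \<open>k\<close> coordinates have been sorted, no direction has gained violations.
  Hence sorted coordinates stay sorted, and each further step changes at most as many points as the
  original \<open>f\<close> has violations there.\<close>

lemma ex_unate_close:
  "\<exists>g. unate n g \<and> distance n f g \<le> (\<Sum>i<n. card (violations n i (b i) f)) / 2 ^ n"
proof -
  have "\<exists>g. card {x \<in> cube n. f x \<noteq> g x} \<le> (\<Sum>i<k. card (violations n i (b i) f)) \<and>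
      (\<forall>i<k. violations n i (b i) g = {}) \<and>
      (\<forall>i<n. card (violations n i (b i) g) \<le> card (violations n i (b i) f))"
    if "k \<le> n" for k
    using that
  proof (induction k)
    case 0
    show ?case by (intro exI[of _ f]) auto
  next
    case (Suc k)
    then obtain g where g:
      "card {x \<in> cube n. f x \<noteq> g x} \<le> (\<Sum>i<k. card (violations n i (b i) f))"
      "\<And>i. i < k \<Longrightarrow> violations n i (b i) g = {}"
      "\<And>i. i < n \<Longrightarrow> card (violations n i (b i) g) \<le> card (violations n i (b i) f)"
      by auto
    define g' where "g' = sort_coord k (b k) g"
    have k: "k < n" using Suc.prems by simp
    have le: "card (violations n i (b i) g') \<le> card (violations n i (b i) g)" for i
      using card_violations_sort_coord_le[OF k, of i] unfolding g'_def by (cases "i = k") auto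
    have "{x \<in> cube n. f x \<noteq> g' x} \<subseteq> {x \<in> cube n. f x \<noteq> g x} \<union> {x \<in> cube n. g x \<noteq> g' x}"
      by auto
    also have "\<dots> \<subseteq> {x \<in> cube n. f x \<noteq> g x} \<union> violations n k (b k) g"
      using sort_coord_changes[of n g k "b k"] unfolding g'_def by blast
    finally have "card {x \<in> cube n. f x \<noteq> g' x} \<le>
        card ({x \<in> cube n. f x \<noteq> g x} \<union> violations n k (b k) g)"
      by (intro card_mono) auto
    also have "\<dots> \<le> card {x \<in> cube n. f x \<noteq> g x} + card (violations n k (b k) g)"
      by (rule card_Un_le)
    finally have "card {x \<in> cube n. f x \<noteq> g' x} \<le> (\<Sum>i<Suc k. card (violations n i (b i) f))"
      using g(1) g(3)[OF k] by simp
    moreover have "violations n i (b i) g' = {}" if "i < Suc k" for i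
    proof (cases "i = k")
      case True
      then show ?thesis by (simp add: g'_def)
    next
      case False
      then show ?thesis using le[of i] g(2)[of i] that by simp
    qed
    ultimately show ?case using le g(3) order_trans by blast
  qed
  from this[of n] obtain g where g:
    "card {x \<in> cube n. f x \<noteq> g x} \<le> (\<Sum>i<n. card (violations n i (b i) f))"
    "\<And>i. i < n \<Longrightarrow> violations n i (b i) g = {}"
    by auto
  have "distance n f g \<le> (\<Sum>i<n. card (violations n i (b i) f)) / 2 ^ n"
    unfolding distance_eq_card using g(1)
    by (intro divide_right_mono) (simp_all flip: of_nat_sum)
  moreover have "unate n g" unfolding unate_iff using g(2) by (intro allI impI exI)
  ultimately show ?thesis by blast
qed

text \<open>For \<open>i < n\<close> this is a fraction of edges: there are
  \<open>2 ^ (n - 1)\<close> of them in direction \<open>i\<close>, and each violating one is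
  counted at both endpoints.\<close>

definition violation_rate :: "nat \<Rightarrow> ((nat \<Rightarrow> bool) \<Rightarrow> bool) \<Rightarrow> nat \<Rightarrow> bool \<Rightarrow> real" where
  "violation_rate n f i b = card (violations n i b f) / 2 ^ n"

text \<open>Sorting every coordinate in its cheaper direction reaches a unate function, which must
  be at distance at least \<open>\<epsilon>\<close>.\<close>

lemma far_from_unate_le_sum_min:
  assumes "far_from_unate n \<epsilon> f"
  shows "\<epsilon> \<le> (\<Sum>i<n. min (violation_rate n f i True) (violation_rate n f i False))"
proof -
  define b where "b i \<longleftrightarrow> violation_rate n f i True \<le> violation_rate n f i False" for i
  obtain g where "unate n g" "distance n f g \<le> (\<Sum>i<n. card (violations n i (b i) f)) / 2 ^ n"
    using ex_unate_close by blast
  with assms have "\<epsilon> \<le> (\<Sum>i<n. violation_rate n f i (b i))"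
    unfolding far_from_unate_def violation_rate_def by (force simp: sum_divide_distrib)
  also have "\<dots> = (\<Sum>i<n. min (violation_rate n f i True) (violation_rate n f i False))"
    by (intro sum.cong refl) (auto simp: b_def min_def)
  finally show ?thesis .
qed

text \<open>Constant functions are unate and distances are probabilities. For
  \<open>\<epsilon> > 1\<close> a tester may therefore accept everything.\<close>

lemma far_from_unate_le_1: "far_from_unate n \<epsilon> f \<Longrightarrow> \<epsilon> \<le> 1"
proof -
  assume far: "far_from_unate n \<epsilon> f"
  have "unate n (\<lambda>_. True)"
    by (simp add: unate_iff violations_def)
  then have "\<epsilon> \<le> distance n f (\<lambda>_. True)"
    using far unfolding far_from_unate_def by blast
  then show "\<epsilon> \<le> 1"
    unfolding distance_def using measure_pmf.prob_le_1 order_trans by blast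
qed

text \<open>\<open>cube 1\<close> is a single edge, which cannot violate both directions. The query
  bound is 0 for \<open>n = 1\<close>, so this case must be settled without queries.\<close>

lemma unate_1: "unate 1 f"
proof -
  have *: "x(0 := c) = y(0 := c)" if "x \<in> cube 1" "y \<in> cube 1" for x y :: "nat \<Rightarrow> bool" and c
    using that unfolding cube_def by (intro ext) (auto simp: PiE_iff extensional_def)
  obtain z :: "nat \<Rightarrow> bool" where z: "z \<in> cube 1"
    using cube_nonempty by blast
  have "violations 1 0 b f = {}" if "f (z(0 := b))" for b
    unfolding violations_def using *[OF z] that by auto
  moreover have "violations 1 0 b f = {}" if "\<not> f (z(0 := \<not> b))" for b
    unfolding violations_def using *[OF z] that by auto
  ultimately have "\<exists>b. violations 1 0 b f = {}" by metis
  then show ?thesis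
    unfolding unate_iff by simp
qed

section \<open>Randomized query trees\<close>

text \<open>A tree fixes its continuations for both answers before the answer is known, so both are
  drawn in advance, independently.\<close>

definition random_query :: "'p \<Rightarrow> (bool \<Rightarrow> 'p query_tree pmf) \<Rightarrow> 'p query_tree pmf" where
  "random_query x P =
     map_pmf (\<lambda>(t, u). Query x (\<lambda>b. if b then t else u)) (pair_pmf (P True) (P False))"

lemma finite_set_random_query:
  "(\<And>b. finite (set_pmf (P b))) \<Longrightarrow> finite (set_pmf (random_query x P))"
  unfolding random_query_def by simp

lemma query_points_random_query:
  assumes "x \<in> A" "\<And>b t. t \<in> set_pmf (P b) \<Longrightarrow> query_points t \<subseteq> A"
    and "t \<in> set_pmf (random_query x P)"
  shows "query_points t \<subseteq> A"
  using assms(3) unfolding random_query_def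
  by (auto dest!: subsetD[OF assms(2)] simp: assms(1) split: if_splits)

text \<open>For fixed \<open>f\<close> only the subtree at the answer \<open>f x\<close> is
  followed, and its marginal distribution is \<open>P (f x)\<close>. Keeping \<open>h\<close> and
  \<open>h'\<close> apart allows a query to be charged.\<close>

lemma expectation_random_query:
  fixes h h' :: "'p query_tree \<Rightarrow> real"
  assumes "\<And>k. h (Query x k) = h' (k (f x))"
  shows "measure_pmf.expectation (random_query x P) h = measure_pmf.expectation (P (f x)) h'"
proof -
  have "measure_pmf.expectation (random_query x P) h =
      measure_pmf.expectation (pair_pmf (P True) (P False)) (\<lambda>z. h' (if f x then fst z else snd z))"
    unfolding random_query_def by (auto simp: assms case_prod_beta)
  also have "\<dots> = measure_pmf.expectation
      (map_pmf (if f x then fst else snd) (pair_pmf (P True) (P False))) h'"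
    by simp
  also have "map_pmf (if f x then fst else snd) (pair_pmf (P True) (P False)) = P (f x)"
    by (simp add: map_fst_pair_pmf map_snd_pair_pmf)
  finally show ?thesis .
qed

text \<open>On a non-constant edge the value \<open>a\<close> at the lower endpoint is also the
  direction that the edge violates, so \<open>Q\<close> learns this direction.\<close>

definition sample_edge :: "nat \<Rightarrow> nat \<Rightarrow> randomized_tester \<Rightarrow> (bool \<Rightarrow> randomized_tester) \<Rightarrow> randomized_tester" where
  "sample_edge n i P Q = pmf_of_set (cube n) \<bind>
     (\<lambda>x. random_query (x(i := False)) (\<lambda>a. random_query (x(i := True)) (\<lambda>b. if a = b then P else Q a)))"

lemma finite_set_sample_edge:
  "finite (set_pmf P) \<Longrightarrow> (\<And>b. finite (set_pmf (Q b))) \<Longrightarrow> finite (set_pmf (sample_edge n i P Q))"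
  unfolding sample_edge_def by (auto intro!: finite_set_random_query)

lemma query_points_sample_edge:
  assumes "i < n" "\<And>t. t \<in> set_pmf P \<Longrightarrow> query_points t \<subseteq> cube n"
    and "\<And>b t. t \<in> set_pmf (Q b) \<Longrightarrow> query_points t \<subseteq> cube n"
    and "t \<in> set_pmf (sample_edge n i P Q)"
  shows "query_points t \<subseteq> cube n"
proof -
  obtain x where x: "x \<in> cube n" and t: "t \<in> set_pmf (random_query (x(i := False))
      (\<lambda>a. random_query (x(i := True)) (\<lambda>b. if a = b then P else Q a)))"
    using assms(4) unfolding sample_edge_def by auto
  show ?thesis
    by (rule query_points_random_query[OF _ query_points_random_query t])
      (use assms(1-3) x in \<open>auto intro: fun_upd_in_cube split: if_splits\<close>)
qed

lemma expectation_sample_edge: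
  fixes h h' h'' :: "(nat \<Rightarrow> bool) query_tree \<Rightarrow> real"
  assumes "\<And>x k. h (Query x k) = h' (k (f x))" "\<And>x k. h' (Query x k) = h'' (k (f x))"
    and fin: "finite (set_pmf P)" "\<And>b. finite (set_pmf (Q b))"
  shows "measure_pmf.expectation (sample_edge n i P Q) h =
    (1 - violation_rate n f i True - violation_rate n f i False) * measure_pmf.expectation P h''
    + violation_rate n f i True * measure_pmf.expectation (Q True) h''
    + violation_rate n f i False * measure_pmf.expectation (Q False) h''"
    (is "_ = (1 - ?u - ?d) * ?p + ?u * ?q True + ?d * ?q False")
proof -
  let ?v = "\<lambda>b x. of_bool (f (x(i := \<not> b)) \<and> \<not> f (x(i := b))) :: real"
  have rate: "(\<Sum>x\<in>cube n. ?v b x) = 2 ^ n * violation_rate n f i b" for b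
    unfolding violation_rate_def card_violations by simp
  have "measure_pmf.expectation (sample_edge n i P Q) h =
     (\<Sum>x\<in>cube n. measure_pmf.expectation
        (if f (x(i := False)) = f (x(i := True)) then P else Q (f (x(i := False)))) h'' / 2 ^ n)"
    unfolding sample_edge_def
    by (subst pmf_expectation_bind_pmf_of_set)
      (auto intro!: finite_set_random_query sum.cong simp: fin card_cube divide_inverse_commute
        expectation_random_query[of h _ h' f, OF assms(1)]
        expectation_random_query[of h' _ h'' f, OF assms(2)])
  \<comment> \<open>The two indicators exclude each other, so the case distinction is linear in them
    and their sums are given by the rates.\<close>
  also have "\<dots> = (\<Sum>x\<in>cube n. ?p + (?q True - ?p) * ?v True x + (?q False - ?p) * ?v False x) / 2 ^ n"
    unfolding sum_divide_distrib by (intro sum.cong refl) auto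
  also have "\<dots> = (1 - ?u - ?d) * ?p + ?u * ?q True + ?d * ?q False"
    by (simp only: sum.distrib rate flip: sum_distrib_left) (simp add: card_cube field_simps)
  finally show ?thesis .
qed

section \<open>The tester\<close>

text \<open>
  Having seen an edge in direction \<open>i\<close> that violates \<open>b\<close>, keep sampling until another non-constant
  edge is found, and reject if it violates \<open>\<not> b\<close>; the argument \<open>m\<close> bounds the number of attempts.
\<close>

primrec search_edge :: "nat \<Rightarrow> nat \<Rightarrow> bool \<Rightarrow> randomized_tester \<Rightarrow> nat \<Rightarrow> randomized_tester" where
  "search_edge n i b K 0 = K"
| "search_edge n i b K (Suc m) = sample_edge n i (search_edge n i b K m)
     (\<lambda>c. if c = b then K else return_pmf (Verdict False))"

text \<open>A nonzero edge rate is at least \<open>1 / 2 ^ n\<close>, so \<open>2 ^ n\<close>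
  attempts miss with probability at most 1/2. Bounding the attempts also keeps supports
  finite.\<close>

definition test_coord :: "nat \<Rightarrow> nat \<Rightarrow> randomized_tester \<Rightarrow> randomized_tester" where
  "test_coord n i K = sample_edge n i K (\<lambda>b. search_edge n i b K (2 ^ n))"

text \<open>The rest of the run is passed as the continuation \<open>K\<close>, which a rejection
  discards; acceptance probabilities then multiply. Repeated entries in \<open>js\<close> encode
  several passes.\<close>

definition test_coords :: "nat \<Rightarrow> nat list \<Rightarrow> randomized_tester" where
  "test_coords n js = foldr (test_coord n) js (return_pmf (Verdict True))"

lemma test_coords_simps [simp]:
  "test_coords n [] = return_pmf (Verdict True)"
  "test_coords n (i # js) = test_coord n i (test_coords n js)"
  unfolding test_coords_def by simp_all

section \<open>Finite supports and queries inside the cube\<close>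

lemma finite_set_search_edge:
  "finite (set_pmf K) \<Longrightarrow> finite (set_pmf (search_edge n i b K m))"
  by (induction m) (auto intro!: finite_set_sample_edge)

lemma finite_set_test_coords: "finite (set_pmf (test_coords n js))"
  by (induction js) (auto simp: test_coord_def intro!: finite_set_sample_edge finite_set_search_edge)

lemma query_points_search_edge:
  assumes "i < n" "\<And>t. t \<in> set_pmf K \<Longrightarrow> query_points t \<subseteq> cube n"
    and "t \<in> set_pmf (search_edge n i b K m)"
  shows "query_points t \<subseteq> cube n"
  using assms(3)
proof (induction m arbitrary: t)
  case 0
  then show ?case using assms(2) by simp
next
  case (Suc m)
  show ?case
    by (rule query_points_sample_edge[OF assms(1) Suc.IH _ Suc.prems[unfolded search_edge.simps]])
      (use assms(2) in \<open>auto split: if_splits\<close>)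
qed

lemma query_points_test_coords:
  assumes "set js \<subseteq> {..<n}" "t \<in> set_pmf (test_coords n js)"
  shows "query_points t \<subseteq> cube n"
  using assms
proof (induction js arbitrary: t)
  case Nil
  then show ?case by simp
next
  case (Cons i js)
  have i: "i < n" and K: "\<And>t. t \<in> set_pmf (test_coords n js) \<Longrightarrow> query_points t \<subseteq> cube n"
    using Cons by auto
  show ?case
    by (rule query_points_sample_edge[OF i K query_points_search_edge[OF i K]
          Cons.prems(2)[unfolded test_coords_simps test_coord_def]])
qed

section \<open>Acceptance probability and expected cost\<close>

abbreviation acceptance :: "((nat \<Rightarrow> bool) \<Rightarrow> bool) \<Rightarrow> randomized_tester \<Rightarrow> real" where
  "acceptance f P \<equiv> measure_pmf.expectation P (\<lambda>t. of_bool (accepts f t))"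

abbreviation cost :: "((nat \<Rightarrow> bool) \<Rightarrow> bool) \<Rightarrow> randomized_tester \<Rightarrow> real" where
  "cost f P \<equiv> measure_pmf.expectation P (\<lambda>t. real (num_queries f t))"

lemma violation_rate_nonneg [simp]: "0 \<le> violation_rate n f i b"
  unfolding violation_rate_def by simp

definition edge_rate :: "nat \<Rightarrow> ((nat \<Rightarrow> bool) \<Rightarrow> bool) \<Rightarrow> nat \<Rightarrow> real" where
  "edge_rate n f i = violation_rate n f i True + violation_rate n f i False"

lemma edge_rate_nonneg: "0 \<le> edge_rate n f i"
  unfolding edge_rate_def by simp

lemma edge_rate_le_1: "edge_rate n f i \<le> 1"
proof -
  have "card (violations n i True f) + card (violations n i False f) =
      card (violations n i True f \<union> violations n i False f)"
    by (rule card_Un_disjoint[symmetric]) (auto simp: violations_def)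
  also have "\<dots> \<le> card (cube n)"
    by (intro card_mono) (auto simp: violations_def)
  finally have "real (card (violations n i True f) + card (violations n i False f)) \<le> real (2 ^ n)"
    unfolding card_cube by (rule of_nat_mono)
  then show ?thesis
    unfolding edge_rate_def violation_rate_def by (simp flip: add_divide_distrib)
qed

lemma acceptance_eq_prob: "acceptance f P = measure_pmf.prob P {t. accepts f t}"
proof -
  have "(\<lambda>t. of_bool (accepts f t) :: real) = indicator {t. accepts f t}"
    by (auto simp: indicator_def)
  then show ?thesis by simp
qed

lemma acceptance_sample_edge:
  assumes "finite (set_pmf P)" "\<And>b. finite (set_pmf (Q b))"
  shows "acceptance f (sample_edge n i P Q) =
    (1 - edge_rate n f i) * acceptance f P
    + violation_rate n f i True * acceptance f (Q True)
    + violation_rate n f i False * acceptance f (Q False)"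
  by (subst expectation_sample_edge[where f = f and h' = "\<lambda>t. of_bool (accepts f t)"
        and h'' = "\<lambda>t. of_bool (accepts f t)"]) (simp_all add: assms edge_rate_def)

text \<open>Every outcome costs two queries and the outcome probabilities sum to 1, so the 2 splits
  off.\<close>

lemma cost_sample_edge:
  assumes "finite (set_pmf P)" "\<And>b. finite (set_pmf (Q b))"
  shows "cost f (sample_edge n i P Q) =
    2 + (1 - edge_rate n f i) * cost f P
    + violation_rate n f i True * cost f (Q True)
    + violation_rate n f i False * cost f (Q False)"
proof -
  have *: "measure_pmf.expectation R (\<lambda>t. real (num_queries f t) + 2) = cost f R + 2"
    if "finite (set_pmf R)" for R
    using that by (simp add: integrable_measure_pmf_finite)
  have "cost f (sample_edge n i P Q) = (1 - edge_rate n f i) * (cost f P + 2)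
      + violation_rate n f i True * (cost f (Q True) + 2)
      + violation_rate n f i False * (cost f (Q False) + 2)"
    unfolding *[OF assms(1), symmetric] *[OF assms(2), symmetric] edge_rate_def diff_diff_eq[symmetric]
    by (rule expectation_sample_edge[where h' = "\<lambda>t. real (num_queries f t) + 1"])
      (simp_all add: assms)
  then show ?thesis by (simp add: edge_rate_def algebra_simps)
qed

context
  fixes n i :: nat and f :: "(nat \<Rightarrow> bool) \<Rightarrow> bool" and K :: randomized_tester
  assumes finite_K: "finite (set_pmf K)"
begin

private abbreviation "p \<equiv> edge_rate n f i"

text \<open>With \<open>q = (1 - p) ^ m\<close>, the search misses with probability \<open>q\<close>
  and otherwise finds an edge violating \<open>b\<close> with conditional probability
  \<open>violation_rate n f i b / p\<close>; both outcomes continue with \<open>K\<close>. The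
  factor \<open>p\<close> avoids dividing by 0.\<close>

lemma acceptance_search_edge:
  "p * acceptance f (search_edge n i b K m) =
     (violation_rate n f i b + violation_rate n f i (\<not> b) * (1 - p) ^ m) * acceptance f K"
proof (induction m)
  case 0
  show ?case unfolding edge_rate_def by (cases b) auto
next
  case (Suc m)
  have "p * acceptance f (search_edge n i b K (Suc m)) =
      (1 - p) * (p * acceptance f (search_edge n i b K m)) + p * violation_rate n f i b * acceptance f K"
    by (cases b) (simp_all add: acceptance_sample_edge finite_K finite_set_search_edge algebra_simps)
  also have "\<dots> = (violation_rate n f i b + violation_rate n f i (\<not> b) * (1 - p) ^ Suc m) * acceptance f K"
    unfolding Suc.IH by (simp add: algebra_simps)
  finally show ?case .
qed

text \<open>The waiting time is a truncated geometric one: at most \<open>1 / p\<close> expected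
  edges of two queries each, followed by at most one run of \<open>K\<close>.\<close>

lemma cost_search_edge: "p * cost f (search_edge n i b K m) \<le> 2 + p * cost f K"
proof (induction m)
  case 0
  then show ?case by simp
next
  case (Suc m)
  have cost_nonneg: "0 \<le> cost f K" by simp
  have "violation_rate n f i b \<le> p"
    unfolding edge_rate_def by (cases b) auto
  then have "p * (violation_rate n f i b * cost f K) \<le> p * (p * cost f K)"
    by (intro mult_left_mono mult_right_mono) (auto simp: edge_rate_nonneg)
  moreover have "(1 - p) * (p * cost f (search_edge n i b K m)) \<le> (1 - p) * (2 + p * cost f K)"
    by (intro mult_left_mono Suc.IH) (simp add: edge_rate_le_1)
  moreover have "p * cost f (search_edge n i b K (Suc m)) =
      2 * p + (1 - p) * (p * cost f (search_edge n i b K m)) + p * (violation_rate n f i b * cost f K)"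
    by (cases b) (simp_all add: cost_sample_edge finite_K finite_set_search_edge algebra_simps)
  ultimately show ?case by (simp add: algebra_simps)
qed

text \<open>The first edge costs 2 queries. A search follows with probability \<open>p\<close> and
  costs at most \<open>2 / p\<close>, which adds another 2.\<close>

lemma cost_test_coord: "cost f (test_coord n i K) \<le> 4 + cost f K"
proof (cases "p = 0")
  case True
  then have "violation_rate n f i True = 0" "violation_rate n f i False = 0"
    unfolding edge_rate_def by (simp_all add: add_nonneg_eq_0_iff)
  then show ?thesis
    unfolding test_coord_def by (simp add: cost_sample_edge finite_K finite_set_search_edge True)
next
  case False
  then have pos: "0 < p" using edge_rate_nonneg[of n f i] by simp
  let ?S = "\<lambda>b. cost f (search_edge n i b K (2 ^ n))"
  have S: "?S b \<le> 2 / p + cost f K" for b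
    using cost_search_edge[of b "2 ^ n"] pos by (simp add: field_simps)
  have "cost f (test_coord n i K) = 2 + (1 - p) * cost f K +
      violation_rate n f i True * ?S True + violation_rate n f i False * ?S False"
    unfolding test_coord_def by (simp add: cost_sample_edge finite_K finite_set_search_edge)
  also have "\<dots> \<le> 2 + (1 - p) * cost f K + violation_rate n f i True * (2 / p + cost f K)
      + violation_rate n f i False * (2 / p + cost f K)"
    by (intro add_mono mult_left_mono S) (auto simp: edge_rate_le_1)
  also have "\<dots> = 2 + (1 - p) * cost f K + p * (2 / p + cost f K)"
    by (simp add: edge_rate_def distrib_right)
  also have "\<dots> = 4 + cost f K" using pos by (simp add: field_simps)
  finally show ?thesis .
qed

text \<open>Rejection needs a non-constant edge and then one of the opposite kind before the
  attempts run out. The two orders contribute equally, hence the factor 2.\<close>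

lemma acceptance_test_coord:
  "p * acceptance f (test_coord n i K) =
     (p - 2 * violation_rate n f i True * violation_rate n f i False * (1 - (1 - p) ^ 2 ^ n)) * acceptance f K"
proof -
  let ?u = "violation_rate n f i True" and ?d = "violation_rate n f i False"
  have "p * acceptance f (test_coord n i K) = (1 - p) * p * acceptance f K
      + ?u * (p * acceptance f (search_edge n i True K (2 ^ n)))
      + ?d * (p * acceptance f (search_edge n i False K (2 ^ n)))"
    unfolding test_coord_def
    by (simp add: acceptance_sample_edge finite_K finite_set_search_edge algebra_simps)
  also have "\<dots> = ((1 - p) * p + ?u\<^sup>2 + ?d\<^sup>2 + 2 * ?u * ?d * (1 - p) ^ 2 ^ n) * acceptance f K"
    unfolding acceptance_search_edge by (simp add: algebra_simps power2_eq_square)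
  also have "(1 - p) * p + ?u\<^sup>2 + ?d\<^sup>2 + 2 * ?u * ?d * (1 - p) ^ 2 ^ n =
      p - 2 * ?u * ?d * (1 - (1 - p) ^ 2 ^ n)"
    unfolding edge_rate_def by (simp add: algebra_simps power2_eq_square)
  finally show ?thesis .
qed

text \<open>Two non-constant edges cannot disagree here, which is the source of one-sided error. The
  case \<open>p = 0\<close> is separate because the identity multiplied by \<open>p\<close> is then
  empty.\<close>

lemma acceptance_test_coord_eq:
  assumes "violation_rate n f i True = 0 \<or> violation_rate n f i False = 0"
  shows "acceptance f (test_coord n i K) = acceptance f K"
proof (cases "p = 0")
  case True
  then have "violation_rate n f i True = 0" "violation_rate n f i False = 0"
    unfolding edge_rate_def by (simp_all add: add_nonneg_eq_0_iff)
  then show ?thesis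
    unfolding test_coord_def by (simp add: acceptance_sample_edge finite_K finite_set_search_edge True)
next
  case False
  then show ?thesis using acceptance_test_coord assms by auto
qed

lemma acceptance_test_coord_le:
  "acceptance f (test_coord n i K) \<le>
     (1 - min (violation_rate n f i True) (violation_rate n f i False) / 2) * acceptance f K"
proof (cases "violation_rate n f i True = 0 \<or> violation_rate n f i False = 0")
  case True
  then have "min (violation_rate n f i True) (violation_rate n f i False) = 0"
    by (auto simp: min_def antisym)
  then show ?thesis using acceptance_test_coord_eq[OF True] by simp
next
  case False
  let ?u = "violation_rate n f i True" and ?d = "violation_rate n f i False"
  have pos: "0 < ?u" "0 < ?d"
    using False by (simp_all add: less_le)
  have p: "0 < p" using pos unfolding edge_rate_def by simp
  \<comment> \<open>Rates are multiples of \<open>1 / 2 ^ n\<close>, so a positive one cannot be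
    smaller than that.\<close>
  have "1 \<le> card (violations n i True f)"
    using pos(1) unfolding violation_rate_def
    by (metis One_nat_def Suc_leI div_0 less_irrefl neq0_conv of_nat_0)
  then have "1 / 2 ^ n \<le> ?u"
    unfolding violation_rate_def by (intro divide_right_mono) auto
  then have "1 / 2 ^ n \<le> p"
    using pos(2) unfolding edge_rate_def by linarith
  then have p_ge: "1 \<le> p * 2 ^ n"
    by (simp add: field_simps)
  have "(1 - p) ^ 2 ^ n \<le> exp (- p) ^ 2 ^ n"
    using exp_ge_add_one_self[of "- p"] edge_rate_le_1 by (intro power_mono) auto
  also have "\<dots> = exp (- (p * 2 ^ n))"
    by (simp flip: exp_of_nat_mult add: mult.commute)
  also have "\<dots> \<le> exp (- 1)" using p_ge by simp
  also have "\<dots> \<le> 1 / 2"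
    using exp_ge_add_one_self[of "1 :: real"] by (simp add: exp_minus field_simps)
  finally have q: "(1 - p) ^ 2 ^ n \<le> 1 / 2" .
  \<comment> \<open>The larger rate is at least half of their sum \<open>p\<close>, so
    \<open>?u * ?d / p\<close> is at least half of the smaller rate.\<close>
  have "?u * ?d = min ?u ?d * max ?u ?d" by (simp add: min_def max_def)
  also have "\<dots> \<ge> min ?u ?d * (p / 2)"
    unfolding edge_rate_def by (intro mult_left_mono) auto
  finally have "p * (min ?u ?d / 2) \<le> ?u * ?d" by (simp add: mult.commute)
  also have "\<dots> = 2 * ?u * ?d * (1 / 2)" by simp
  also have "\<dots> \<le> 2 * ?u * ?d * (1 - (1 - p) ^ 2 ^ n)"
    using q by (intro mult_left_mono) auto
  finally have "p * acceptance f (test_coord n i K) \<le> (p - p * (min ?u ?d / 2)) * acceptance f K"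
    unfolding acceptance_test_coord by (intro mult_right_mono) auto
  then have "p * acceptance f (test_coord n i K) \<le> p * ((1 - min ?u ?d / 2) * acceptance f K)"
    by (simp add: algebra_simps)
  then show ?thesis using p by simp
qed

end

lemma cost_test_coords: "cost f (test_coords n js) \<le> 4 * length js"
proof (induction js)
  case Nil
  then show ?case by simp
next
  case (Cons i js)
  then show ?case
    using cost_test_coord[OF finite_set_test_coords[of n js], where n = n and i = i and f = f] by simp
qed

text \<open>Each test contributes a factor \<open>1 - x \<le> exp (- x)\<close>, so the product
  becomes the exponential of a sum of rates.\<close>

lemma acceptance_test_coords_le:
  "acceptance f (test_coords n js) \<le>
     exp (- (\<Sum>i\<leftarrow>js. min (violation_rate n f i True) (violation_rate n f i False)) / 2)"
proof (induction js)
  case Nil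
  then show ?case by simp
next
  case (Cons i js)
  let ?m = "min (violation_rate n f i True) (violation_rate n f i False)"
  have "acceptance f (test_coords n (i # js)) \<le> (1 - ?m / 2) * acceptance f (test_coords n js)"
    using acceptance_test_coord_le[OF finite_set_test_coords] by simp
  also have "\<dots> \<le> exp (- ?m / 2) * acceptance f (test_coords n js)"
    using exp_ge_add_one_self[of "- ?m / 2"] by (intro mult_right_mono) auto
  also have "\<dots> \<le> exp (- ?m / 2) *
      exp (- (\<Sum>i\<leftarrow>js. min (violation_rate n f i True) (violation_rate n f i False)) / 2)"
    by (intro mult_left_mono Cons.IH) auto
  finally show ?case by (simp add: diff_divide_distrib flip: exp_add)
qed

text \<open>Acceptance with probability 1 under a discrete distribution means that every tree in the
  support accepts.\<close>

lemma accepts_test_coords_if_unate: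
  assumes "unate n f" "set js \<subseteq> {..<n}" "t \<in> set_pmf (test_coords n js)"
  shows "accepts f t"
proof -
  have "acceptance f (test_coords n js) = 1"
    using assms(2)
  proof (induction js)
    case Nil
    then show ?case by simp
  next
    case (Cons i js)
    then have rate: "violation_rate n f i True = 0 \<or> violation_rate n f i False = 0"
      using assms(1) unfolding unate_iff violation_rate_def
      by simp (metis (full_types) finite_violations card_0_eq)
    then show ?case
      using Cons acceptance_test_coord_eq[OF finite_set_test_coords[of n js] rate] by simp
  qed
  then have "measure_pmf.prob (test_coords n js) {t. accepts f t} = 1"
    by (simp add: acceptance_eq_prob)
  then show ?thesis
    using assms(3) by (auto simp: measure_pmf.prob_eq_1 AE_measure_pmf_iff)
qed

section \<open>Cutting off long runs\<close>

primrec truncate :: "'p query_tree \<Rightarrow> nat \<Rightarrow> 'p query_tree" where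
  "truncate (Verdict b) m = Verdict b"
| "truncate (Query x k) m =
     (if m = 0 then Verdict True else Query x (\<lambda>b. truncate (k b) (m - 1)))"

lemma query_points_truncate: "query_points (truncate t m) \<subseteq> query_points t"
proof (induction t arbitrary: m)
  case (Query x k)
  then have "query_points (truncate (k b) l) \<subseteq> query_points (k b)" for b l by simp
  then show ?case by (cases m) (auto dest: subsetD)
qed simp

lemma num_queries_truncate: "num_queries f (truncate t m) \<le> m"
proof (induction t arbitrary: m)
  case (Query x k)
  then show ?case by (cases m) auto
qed simp

text \<open>An exhausted budget yields acceptance, so truncation preserves one-sided error. A run of
  exactly \<open>m\<close> queries is not cut, hence the strict inequality.\<close>

lemma accepts_truncate: "accepts f (truncate t m) \<longleftrightarrow> accepts f t \<or> m < num_queries f t"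
proof (induction t arbitrary: m)
  case (Query x k)
  then show ?case by (cases m) auto
qed simp

lemma sum_list_concat_replicate: "(\<Sum>x\<leftarrow>concat (replicate m xs). h x) = real m * (\<Sum>x\<leftarrow>xs. h x)"
  for h :: "'a \<Rightarrow> real"
  by (induction m) (simp_all add: algebra_simps)

text \<open>Two bad events have probability at most 1/20 each: all tests pass, bounded by
  \<open>exp (- 5)\<close>, or the run is cut off. The cutoff is 20 times the bound
  \<open>4 * (n * R)\<close> on the expected cost, so Markov's inequality covers the latter.\<close>

lemma far_from_unate_rejected:
  assumes far: "far_from_unate n \<epsilon> f" and "0 < \<epsilon>" "1 \<le> n"
    and R: "10 \<le> \<epsilon> * real R"
  shows "9 / 10 \<le> measure_pmf.prob
    (map_pmf (\<lambda>t. truncate t (80 * (n * R))) (test_coords n (concat (replicate R [0..<n]))))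
    {t. \<not> accepts f t}"
proof -
  define P where "P = test_coords n (concat (replicate R [0..<n]))"
  define m where "m = 80 * (n * R)"
  have "(\<Sum>i<n. min (violation_rate n f i True) (violation_rate n f i False)) * R \<ge> \<epsilon> * R"
    by (intro mult_right_mono far_from_unate_le_sum_min far) auto
  then have "acceptance f P \<le> exp (- 5)"
    using R order_trans[OF acceptance_test_coords_le[where f = f and n = n and js = "concat (replicate R [0..<n])"], of "exp (- 5)"]
    unfolding P_def
    by (simp add: sum_list_concat_replicate interv_sum_list_conv_sum_set_nat atLeast0LessThan mult.commute)
  also have "exp (- 5 :: real) = exp (- 1) ^ 5"
    by (simp flip: exp_of_nat_mult)
  also have "\<dots> \<le> (1 / 2) ^ 5"
    using exp_ge_add_one_self[of "1 :: real"] by (intro power_mono) (auto simp: exp_minus field_simps)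
  also have "\<dots> \<le> (1 / 20 :: real)" by (simp add: power_divide)
  finally have accept: "measure_pmf.prob P {t. accepts f t} \<le> 1 / 20"
    by (simp add: acceptance_eq_prob)
  have "R > 0" using R by (cases R) auto
  then have m_pos: "0 < m" using assms(3) unfolding m_def by simp
  have "length (concat (replicate R [0..<n])) = n * R"
    by (induction R) auto
  then have cost: "cost f P / m \<le> 1 / 20"
    using cost_test_coords[where f = f and n = n and js = "concat (replicate R [0..<n])"] m_pos
    unfolding P_def m_def by (simp add: field_simps)
  have "measure_pmf.prob P {t \<in> space P. real m \<le> real (num_queries f t)} \<le> cost f P / m"
    using m_pos by (intro integral_Markov_inequality_measure[where A = "{}"])
      (auto simp: P_def finite_set_test_coords integrable_measure_pmf_finite)
  also note cost
  finally have "measure_pmf.prob P {t. m \<le> num_queries f t} \<le> 1 / 20"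
    by simp
  moreover have "measure_pmf.prob P {t. m < num_queries f t} \<le> measure_pmf.prob P {t. m \<le> num_queries f t}"
    by (intro measure_pmf.finite_measure_mono) auto
  moreover have "measure_pmf.prob P ({t. accepts f t} \<union> {t. m < num_queries f t}) \<le>
      measure_pmf.prob P {t. accepts f t} + measure_pmf.prob P {t. m < num_queries f t}"
    by (intro measure_Un_le) auto
  ultimately have "measure_pmf.prob P ({t. accepts f t} \<union> {t. m < num_queries f t}) \<le> 1 / 10"
    using accept by simp
  moreover have "measure_pmf.prob P (- ({t. accepts f t} \<union> {t. m < num_queries f t})) =
      1 - measure_pmf.prob P ({t. accepts f t} \<union> {t. m < num_queries f t})"
    using measure_pmf.prob_compl[of "{t. accepts f t} \<union> {t. m < num_queries f t}" P]
    by (simp add: Compl_eq_Diff_UNIV)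
  moreover have "(\<lambda>t. truncate t m) -` {t. \<not> accepts f t} =
      - ({t. accepts f t} \<union> {t. m < num_queries f t})"
    by (auto simp: accepts_truncate)
  ultimately show ?thesis
    unfolding P_def[symmetric] m_def[symmetric] by simp
qed

section \<open>Choice of constants and degenerate parameters\<close>

theorem theorem1p2:
  "\<exists>C::real. \<forall>\<epsilon>::real. \<epsilon> > 0 \<longrightarrow>
     (\<exists>T :: nat \<Rightarrow> randomized_tester. \<forall>n\<ge>1.
        (\<forall>t\<in>set_pmf (T n). query_points t \<subseteq> cube n) \<and>
        (\<forall>f :: (nat \<Rightarrow> bool) \<Rightarrow> bool.
           (\<forall>t\<in>set_pmf (T n). real (num_queries f t) \<le> C * (real n * ln (real n) / \<epsilon>)) \<and>
           (unate n f \<longrightarrow> (\<forall>t\<in>set_pmf (T n). accepts f t)) \<and>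
           (far_from_unate n \<epsilon> f \<longrightarrow>
              measure_pmf.prob (T n) {t. \<not> accepts f t} \<ge> 9 / 10)))"
proof (intro exI[of _ "1760::real"] allI impI)
  fix \<epsilon> :: real
  assume \<epsilon>: "\<epsilon> > 0"
  \<comment> \<open>Over \<open>R\<close> passes the smaller rates of a far function add up to at
    least \<open>\<epsilon> * R \<ge> 10\<close>, and halving gives the exponent 5.\<close>
  define R where "R = nat \<lceil>10 / \<epsilon>\<rceil>"
  have R: "10 \<le> \<epsilon> * real R"
    using \<epsilon> real_nat_ceiling_ge[of "10 / \<epsilon>"] unfolding R_def[symmetric] by (simp add: field_simps)
  \<comment> \<open>For \<open>n = 1\<close> the bound \<open>n * ln n\<close> allows no query; for
    \<open>\<epsilon> > 1\<close> the rounding in \<open>R\<close> would spoil the bound. No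
    function is far in either case, so accepting is correct.\<close>
  define T where "T n = (if n = 1 \<or> \<epsilon> > 1 then return_pmf (Verdict True)
    else map_pmf (\<lambda>t. truncate t (80 * (n * R))) (test_coords n (concat (replicate R [0..<n]))))" for n
  show "\<exists>T :: nat \<Rightarrow> randomized_tester. \<forall>n\<ge>1.
        (\<forall>t\<in>set_pmf (T n). query_points t \<subseteq> cube n) \<and>
        (\<forall>f :: (nat \<Rightarrow> bool) \<Rightarrow> bool.
           (\<forall>t\<in>set_pmf (T n). real (num_queries f t) \<le> 1760 * (real n * ln (real n) / \<epsilon>)) \<and>
           (unate n f \<longrightarrow> (\<forall>t\<in>set_pmf (T n). accepts f t)) \<and>
           (far_from_unate n \<epsilon> f \<longrightarrow>
              measure_pmf.prob (T n) {t. \<not> accepts f t} \<ge> 9 / 10))"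
  proof (rule exI[of _ T], intro allI impI)
    fix n :: nat
    assume n: "1 \<le> n"
    show "(\<forall>t\<in>set_pmf (T n). query_points t \<subseteq> cube n) \<and>
        (\<forall>f :: (nat \<Rightarrow> bool) \<Rightarrow> bool.
           (\<forall>t\<in>set_pmf (T n). real (num_queries f t) \<le> 1760 * (real n * ln (real n) / \<epsilon>)) \<and>
           (unate n f \<longrightarrow> (\<forall>t\<in>set_pmf (T n). accepts f t)) \<and>
           (far_from_unate n \<epsilon> f \<longrightarrow>
              measure_pmf.prob (T n) {t. \<not> accepts f t} \<ge> 9 / 10))"
    proof (cases "n = 1 \<or> \<epsilon> > 1")
      case True
      have "\<not> far_from_unate n \<epsilon> f" for f
      proof
        assume far: "far_from_unate n \<epsilon> f"
        then have "n = 1" using True far_from_unate_le_1 by fastforce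
        then have "\<epsilon> \<le> distance n f f"
          using far unate_1 unfolding far_from_unate_def by blast
        then show False using \<epsilon> by (simp add: distance_def)
      qed
      then show ?thesis using True n \<epsilon> by (simp add: T_def)
    next
      case False
      then have T: "T n = map_pmf (\<lambda>t. truncate t (80 * (n * R))) (test_coords n (concat (replicate R [0..<n])))"
        by (simp add: T_def)
      have coords: "set (concat (replicate R [0..<n])) \<subseteq> {..<n}" by auto
      have "real R \<le> 10 / \<epsilon> + 1"
        using \<epsilon> unfolding R_def by simp
      also have "\<dots> \<le> 11 / \<epsilon>" using False \<epsilon> by (simp add: field_simps)
      finally have R_le: "real R \<le> 11 / \<epsilon>" .
      \<comment> \<open>Since \<open>ln (1 / 2) \<le> - 1 / 2\<close>, the logarithm of any
        \<open>n \<ge> 2\<close> is at least 1/2 and can absorb a constant.\<close>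
      have "1 \<le> 2 * ln (2 :: real)" using ln_le_minus_one[of "1 / 2 :: real"] by (simp add: ln_div)
      also have "\<dots> \<le> 2 * ln (real n)" using False n by simp
      finally have "1 \<le> 2 * ln (real n)" .
      then have "80 * (real n * (11 / \<epsilon>)) * 1 \<le> 80 * (real n * (11 / \<epsilon>)) * (2 * ln (real n))"
        using \<epsilon> by (intro mult_left_mono) auto
      moreover have "80 * (real n * real R) \<le> 80 * (real n * (11 / \<epsilon>))"
        using R_le by (intro mult_left_mono) auto
      \<comment> \<open>The constant is 80 * 11 * 2: the cutoff, the rounding of \<open>R\<close>,
        and the lower bound on the logarithm.\<close>
      ultimately have "real (80 * (n * R)) \<le> 1760 * (real n * ln (real n) / \<epsilon>)"
        by simp
      then have queries: "real (num_queries f (truncate t (80 * (n * R)))) \<le> 1760 * (real n * ln (real n) / \<epsilon>)" for f t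
        using num_queries_truncate[of f t "80 * (n * R)"] by (meson of_nat_mono order_trans)
      have *: "(query_points t' \<subseteq> cube n) \<and>
          real (num_queries f t') \<le> 1760 * (real n * ln (real n) / \<epsilon>) \<and>
          (unate n f \<longrightarrow> accepts f t')" if in_T: "t' \<in> set_pmf (T n)" for t' f
      proof -
        obtain t where t: "t \<in> set_pmf (test_coords n (concat (replicate R [0..<n])))"
          and t': "t' = truncate t (80 * (n * R))"
          using in_T unfolding T by auto
        show ?thesis
          unfolding t' accepts_truncate
          using order_trans[OF query_points_truncate query_points_test_coords[OF coords t]] queries
            accepts_test_coords_if_unate[OF _ coords t] by blast
      qed
      have "9 / 10 \<le> measure_pmf.prob (T n) {t. \<not> accepts f t}" if "far_from_unate n \<epsilon> f" for f
        unfolding T by (rule far_from_unate_rejected[OF that \<epsilon> n R])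
      with * show ?thesis by blast
    qed
  qed
qed

end
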